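(* Let $\mathcal{R}$ be a predicative recursive (finite, constructor) term rewrite system over the signature $\mathcal{F}$. Then the innermost derivation height of any basic term $f(u_1,\dots,u_k;v_1,\dots,v_l)$ (with $u_1,\dots,u_k$ the arguments at normal positions and $v_1,\dots,v_l$ those at safe positions) is bounded by a polynomial in $\max_{i=1}^k \mathrm{depth}(u_i)$, the maximal depth of the normal arguments. The polynomial depends only on $\mathcal{R}$ and $\mathcal{F}$. In particular, the innermost runtime complexity of $\mathcal{R}$ is polynomially bounded.
   Context: Terms are built over a finite signature $\mathcal{F}$, partitioned into defined symbols $\mathcal{D}$ and constructors $\mathcal{C}$, and a countably infinite set of variables $\mathcal{V}$. Values are terms built only from variables and constructors. A basic term is a term $f(v_1,\dots,v_n)$ with $f\in\mathcal{D}$ and all $v_i$ values. A constructor TRS is a finite set of rules $l\to r$ ($l\notin\mathcal{V}$, variables of $r$ occur in $l$) whose left-hand sides are all basic terms. Innermost rewriting $\to^{i}$ only contracts redexes whose arguments are normal forms. The innermost derivation height of a term $s$ is the maximal length of an innermost rewrite sequence starting at $s$; the innermost runtime complexity is $\mathrm{rc}(n)=\max\{\text{derivation height of } s \mid s \text{ basic}, |s|\le n\}$, where $|s|$ is the number of symbol and variable occurrences. $\mathrm{depth}(x)=1$ for variables, $\mathrm{depth}(f(t_1,\dots,t_n))=1+\max(\{0\}\cup\{\mathrm{depth}(t_i)\})$. A safe mapping assigns to each $n$-ary symbol $f$ a set of safe argument positions $\subseteq\{1,\dots,n\}$ (the others are normal); for constructors all positions are safe. By convention we write $f(s_1,\dots,s_k;s_{k+1},\dots,s_{k+l})$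 with positions $1..k$ normal and $k+1..k+l$ safe. A precedence is a preorder $\succsim$ on $\mathcal{F}$ with strict part $\succ$ and equivalence $\sim$; it is admissible if $f\sim g$ implies that $f,g$ are both defined or both constructors. Safe equivalence $\approx$: $s\approx t$ iff $s=t$, or $s=f(s_1,\dots,s_n)$, $t=g(t_1,\dots,t_n)$, $f\sim g$ and there is a permutation $\pi$ with $s_i\approx t_{\pi(i)}$ and ($i$ safe for $f$ iff $\pi(i)$ safe for $g$) for all $i$. $\mathcal{T}(\mathcal{F}_{<f},\mathcal{V})$ denotes terms built from variables and symbols $g$ with $f\succ g$. For $s=f(s_1,\dots,s_k;s_{k+1},\dots,s_{k+l})$: $s>_{\mathsf{sq}} t$ iff (i) $s_i\ (>_{\mathsf{sq}}\cup\approx)\ t$ for some $i$, where $i\le k$ if $f\in\mathcal{D}$; or (ii) $f\in\mathcal{D}$, $t=g(t_1,\dots,t_{p})$, $f\succ g$ and $s>_{\mathsf{sq}} t_i$ for all $i$. The polynomial path order $>_{\mathsf{pop*}}$: $s>_{\mathsf{pop*}}t$ iff (1) $s_i\ge_{\mathsf{pop*}} t$ for some $i\in\{1,\dots,k+l\}$; or (2) $f\in\mathcal{D}$, $t=g(t_1,\dots,t_m;t_{m+1},\dots,t_{m+n})$, $f\succ g$, $s>_{\mathsf{sq}}t_j$ for all $j\le m$, $s>_{\mathsf{pop*}}t_j$ for all $j>m$, and $t_j\notin\mathcal{T}(\mathcal{F}_{<f},\mathcal{V})$ for at most one safe position $j$; or (3) $f\in\mathcal{D}$, $t=g(t_1,\dots,t_m;t_{m+1},\dots,t_{m+n})$,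 $f\sim g$, $\{s_1,\dots,s_k\}>^{\mathrm{mul}}_{\mathsf{pop*}}\{t_1,\dots,t_m\}$ and $\{s_{k+1},\dots,s_{k+l}\}\ge^{\mathrm{mul}}_{\mathsf{pop*}}\{t_{m+1},\dots,t_{m+n}\}$. Here $\ge_{\mathsf{pop*}}={>_{\mathsf{pop*}}}\cup{\approx}$; variables are greater than nothing. Multiset extensions are taken modulo $\approx$: $M>^{\mathrm{mul}}N$ iff, on $\approx$-classes, $N=(M\setminus X)\uplus Y$ with $\emptyset\ne X\subseteq M$ and every $y\in Y$ strictly below some $x\in X$; $M\ge^{\mathrm{mul}}N$ iff $M>^{\mathrm{mul}}N$ or $M,N$ agree modulo $\approx$. A constructor TRS $\mathcal{R}$ is predicative recursive if $l>_{\mathsf{pop*}}r$ for all rules, for some safe mapping and some admissible precedence. *)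

theory Defs
  imports
    "HOL-Library.Multiset"
    "HOL-Library.Extended_Nat"
    "HOL-Library.Countable"
    "HOL-Library.Infinite_Typeclass"
    "HOL-Combinatorics.Permutations"
    "HOL-Computational_Algebra.Polynomial"
begin

text \<open>
  The finite signature is a type \<open>'f\<close> of class \<open>finite\<close>, together with an arity function \<open>ar\<close>
  and the set \<open>D\<close> of defined symbols; the constructors are the elements of \<open>- D\<close>.  The variables
  are the elements of \<open>'v\<close>.  Argument positions are list indices, so they run through
  \<open>{..<ar f}\<close> rather than \<open>{1..ar f}\<close>.
\<close>

section \<open>Terms\<close>

datatype (funs_term: 'f, vars_term: 'v) "term" = Var 'v | Fun 'f "('f, 'v) term list"

type_synonym ('f, 'v) trs = "(('f, 'v) term \<times> ('f, 'v) term) set"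

fun wf_term :: "('f \<Rightarrow> nat) \<Rightarrow> ('f, 'v) term \<Rightarrow> bool" where
  "wf_term ar (Var x) \<longleftrightarrow> True"
| "wf_term ar (Fun f ts) \<longleftrightarrow> length ts = ar f \<and> (\<forall>t \<in> set ts. wf_term ar t)"

fun subst :: "('f, 'v) term \<Rightarrow> ('v \<Rightarrow> ('f, 'v) term) \<Rightarrow> ('f, 'v) term" where
  "subst (Var x) \<sigma> = \<sigma> x"
| "subst (Fun f ts) \<sigma> = Fun f (map (\<lambda>t. subst t \<sigma>) ts)"

fun term_size :: "('f, 'v) term \<Rightarrow> nat" where
  "term_size (Var x) = 1"
| "term_size (Fun f ts) = 1 + sum_list (map term_size ts)"

fun depth :: "('f, 'v) term \<Rightarrow> nat" where
  "depth (Var x) = 1"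
| "depth (Fun f ts) = 1 + Max ({0} \<union> depth ` set ts)"

definition is_value :: "('f \<Rightarrow> nat) \<Rightarrow> 'f set \<Rightarrow> ('f, 'v) term \<Rightarrow> bool" where
  "is_value ar D t \<longleftrightarrow> wf_term ar t \<and> funs_term t \<subseteq> - D"

definition is_basic :: "('f \<Rightarrow> nat) \<Rightarrow> 'f set \<Rightarrow> ('f, 'v) term \<Rightarrow> bool" where
  "is_basic ar D t \<longleftrightarrow>
     (\<exists>f vs. t = Fun f vs \<and> f \<in> D \<and> length vs = ar f \<and> (\<forall>v \<in> set vs. is_value ar D v))"

section \<open>Rewriting\<close>

definition is_trs :: "('f \<Rightarrow> nat) \<Rightarrow> ('f, 'v) trs \<Rightarrow> bool" where
  "is_trs ar R \<longleftrightarrow> finite R \<and>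
     (\<forall>(l, r) \<in> R. wf_term ar l \<and> wf_term ar r \<and> (\<nexists>x. l = Var x) \<and> vars_term r \<subseteq> vars_term l)"

definition constructor_trs :: "('f \<Rightarrow> nat) \<Rightarrow> 'f set \<Rightarrow> ('f, 'v) trs \<Rightarrow> bool" where
  "constructor_trs ar D R \<longleftrightarrow> is_trs ar R \<and> (\<forall>(l, r) \<in> R. is_basic ar D l)"

inductive rstep :: "('f, 'v) trs \<Rightarrow> ('f, 'v) term \<Rightarrow> ('f, 'v) term \<Rightarrow> bool" for R where
  root: "(l, r) \<in> R \<Longrightarrow> rstep R (subst l \<sigma>) (subst r \<sigma>)"
| arg: "rstep R s t \<Longrightarrow> rstep R (Fun f (us @ s # vs)) (Fun f (us @ t # vs))"

definition normal_form :: "('f, 'v) trs \<Rightarrow> ('f, 'v) term \<Rightarrow> bool" where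
  "normal_form R s \<longleftrightarrow> (\<nexists>t. rstep R s t)"

inductive istep :: "('f, 'v) trs \<Rightarrow> ('f, 'v) term \<Rightarrow> ('f, 'v) term \<Rightarrow> bool" for R where
  root: "\<lbrakk>(l, r) \<in> R; subst l \<sigma> = Fun f ts; \<forall>t \<in> set ts. normal_form R t\<rbrakk> \<Longrightarrow>
    istep R (Fun f ts) (subst r \<sigma>)"
| arg: "istep R s t \<Longrightarrow> istep R (Fun f (us @ s # vs)) (Fun f (us @ t # vs))"

text \<open>
  Both maxima are suprema in \<^typ>\<open>enat\<close>: the value is \<open>\<infinity>\<close> if there is no bound, and \<open>0\<close> for an
  empty set, so a finite value is an attained maximum unless the set is empty.
\<close>

definition derivation_height :: "('f, 'v) trs \<Rightarrow> ('f, 'v) term \<Rightarrow> enat" where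
  "derivation_height R s = (SUP m \<in> {m. \<exists>t. (istep R ^^ m) s t}. enat m)"

definition runtime_complexity :: "('f \<Rightarrow> nat) \<Rightarrow> 'f set \<Rightarrow> ('f, 'v) trs \<Rightarrow> nat \<Rightarrow> enat" where
  "runtime_complexity ar D R n =
     (SUP s \<in> {s. is_basic ar D s \<and> term_size s \<le> n}. derivation_height R s)"

section \<open>Safe mappings and precedences\<close>

definition safe_mapping :: "('f \<Rightarrow> nat) \<Rightarrow> 'f set \<Rightarrow> ('f \<Rightarrow> nat set) \<Rightarrow> bool" where
  "safe_mapping ar D safe \<longleftrightarrow>
     (\<forall>f. safe f \<subseteq> {..<ar f}) \<and> (\<forall>f. f \<notin> D \<longrightarrow> safe f = {..<ar f})"

definition normal_args :: "('f \<Rightarrow> nat set) \<Rightarrow> 'f \<Rightarrow> 'a list \<Rightarrow> 'a list" where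
  "normal_args safe f ts = nths ts (- safe f)"

definition safe_args :: "('f \<Rightarrow> nat set) \<Rightarrow> 'f \<Rightarrow> 'a list \<Rightarrow> 'a list" where
  "safe_args safe f ts = nths ts (safe f)"

text \<open>A precedence is a relation \<open>P\<close> where \<open>(f, g) \<in> P\<close> means that \<open>f\<close> is above or equivalent to \<open>g\<close>.\<close>

definition prec_gt :: "'f rel \<Rightarrow> 'f \<Rightarrow> 'f \<Rightarrow> bool" where
  "prec_gt P f g \<longleftrightarrow> (f, g) \<in> P \<and> (g, f) \<notin> P"

definition prec_eq :: "'f rel \<Rightarrow> 'f \<Rightarrow> 'f \<Rightarrow> bool" where
  "prec_eq P f g \<longleftrightarrow> (f, g) \<in> P \<and> (g, f) \<in> P"

definition admissible :: "'f set \<Rightarrow> 'f rel \<Rightarrow> bool" where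
  "admissible D P \<longleftrightarrow> (\<forall>f g. prec_eq P f g \<longrightarrow> (f \<in> D \<longleftrightarrow> g \<in> D))"

definition terms_below :: "'f rel \<Rightarrow> 'f \<Rightarrow> ('f, 'v) term set" where
  "terms_below P f = {t. \<forall>g \<in> funs_term t. prec_gt P f g}"

inductive safe_eq :: "('f \<Rightarrow> nat set) \<Rightarrow> 'f rel \<Rightarrow> ('f, 'v) term \<Rightarrow> ('f, 'v) term \<Rightarrow> bool"
  for safe P where
  refl: "safe_eq safe P s s"
| perm: "\<lbrakk>prec_eq P f g; length ss = length ts; \<pi> permutes {..<length ss};
     \<forall>i < length ss. safe_eq safe P (ss ! i) (ts ! \<pi> i) \<and> (i \<in> safe f \<longleftrightarrow> \<pi> i \<in> safe g)\<rbrakk> \<Longrightarrow>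
    safe_eq safe P (Fun f ss) (Fun g ts)"

section \<open>Multiset extension modulo an equivalence\<close>

text \<open>
  The multisets of equivalence classes are given by representatives: \<open>K\<close> is what remains of \<open>M\<close>
  after removing \<open>X\<close>, and \<open>K'\<close> consists of the same classes as \<open>K\<close>.
\<close>

definition mul_gt :: "('a \<Rightarrow> 'a \<Rightarrow> bool) \<Rightarrow> ('a \<Rightarrow> 'a \<Rightarrow> bool) \<Rightarrow> 'a multiset \<Rightarrow> 'a multiset \<Rightarrow> bool" where
  "mul_gt eq gt M N \<longleftrightarrow>
     (\<exists>K K' X Y. M = K + X \<and> N = K' + Y \<and> rel_mset eq K K' \<and> X \<noteq> {#} \<and>
        (\<forall>y \<in># Y. \<exists>x \<in># X. gt x y))"

definition mul_ge :: "('a \<Rightarrow> 'a \<Rightarrow> bool) \<Rightarrow> ('a \<Rightarrow> 'a \<Rightarrow> bool) \<Rightarrow> 'a multiset \<Rightarrow> 'a multiset \<Rightarrow> bool" where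
  "mul_ge eq gt M N \<longleftrightarrow> mul_gt eq gt M N \<or> rel_mset eq M N"

lemma mul_gt_mono [mono]:
  assumes "\<And>x y. gt x y \<longrightarrow> gt' x y"
  shows "mul_gt eq gt M N \<longrightarrow> mul_gt eq gt' M N"
  unfolding mul_gt_def using assms by blast

lemma mul_ge_mono [mono]:
  assumes "\<And>x y. gt x y \<longrightarrow> gt' x y"
  shows "mul_ge eq gt M N \<longrightarrow> mul_ge eq gt' M N"
  unfolding mul_ge_def using mul_gt_mono[of gt gt', OF assms] by blast

section \<open>Polynomial path orders\<close>

inductive sq_gt ::
  "'f set \<Rightarrow> ('f \<Rightarrow> nat set) \<Rightarrow> 'f rel \<Rightarrow> ('f, 'v) term \<Rightarrow> ('f, 'v) term \<Rightarrow> bool"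
  for D safe P where
  arg: "\<lbrakk>i < length ss; f \<in> D \<longrightarrow> i \<notin> safe f;
     sq_gt D safe P (ss ! i) t \<or> safe_eq safe P (ss ! i) t\<rbrakk> \<Longrightarrow>
    sq_gt D safe P (Fun f ss) t"
| prec: "\<lbrakk>f \<in> D; prec_gt P f g; \<forall>t \<in> set ts. sq_gt D safe P (Fun f ss) t\<rbrakk> \<Longrightarrow>
    sq_gt D safe P (Fun f ss) (Fun g ts)"

inductive pop_gt ::
  "'f set \<Rightarrow> ('f \<Rightarrow> nat set) \<Rightarrow> 'f rel \<Rightarrow> ('f, 'v) term \<Rightarrow> ('f, 'v) term \<Rightarrow> bool"
  for D safe P where
  arg: "\<lbrakk>i < length ss; pop_gt D safe P (ss ! i) t \<or> safe_eq safe P (ss ! i) t\<rbrakk> \<Longrightarrow>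
    pop_gt D safe P (Fun f ss) t"
| prec: "\<lbrakk>f \<in> D; prec_gt P f g;
     \<forall>j < length ts. j \<notin> safe g \<longrightarrow> sq_gt D safe P (Fun f ss) (ts ! j);
     \<forall>j < length ts. j \<in> safe g \<longrightarrow> pop_gt D safe P (Fun f ss) (ts ! j);
     card {j. j < length ts \<and> j \<in> safe g \<and> ts ! j \<notin> terms_below P f} \<le> 1\<rbrakk> \<Longrightarrow>
    pop_gt D safe P (Fun f ss) (Fun g ts)"
| mul: "\<lbrakk>f \<in> D; prec_eq P f g;
     mul_gt (safe_eq safe P) (pop_gt D safe P)
       (mset (normal_args safe f ss)) (mset (normal_args safe g ts));
     mul_ge (safe_eq safe P) (pop_gt D safe P)
       (mset (safe_args safe f ss)) (mset (safe_args safe g ts))\<rbrakk> \<Longrightarrow>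
    pop_gt D safe P (Fun f ss) (Fun g ts)"

definition predicative_recursive_via ::
  "('f \<Rightarrow> nat) \<Rightarrow> 'f set \<Rightarrow> ('f, 'v) trs \<Rightarrow> ('f \<Rightarrow> nat set) \<Rightarrow> 'f rel \<Rightarrow> bool" where
  "predicative_recursive_via ar D R safe P \<longleftrightarrow>
     safe_mapping ar D safe \<and> preorder_on UNIV P \<and> admissible D P \<and>
     (\<forall>(l, r) \<in> R. pop_gt D safe P l r)"

definition predicative_recursive :: "('f \<Rightarrow> nat) \<Rightarrow> 'f set \<Rightarrow> ('f, 'v) trs \<Rightarrow> bool" where
  "predicative_recursive ar D R \<longleftrightarrow>
     constructor_trs ar D R \<and> (\<exists>safe P. predicative_recursive_via ar D R safe P)"

end

theory Submission
  imports Defs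
begin

text \<open>
  A rule of a predicative recursive system with root \<open>f\<close> has at most one call to a symbol
  equivalent to \<open>f\<close> on its right-hand side.  The arguments of that call are values, the multiset of
  depths of its normal arguments is smaller than that of the left-hand side, and every other symbol
  above it is below \<open>f\<close>.  By induction along the precedence one obtains polynomials \<open>b\<close> such that,
  if the normal arguments of \<open>f\<close> have depth at most \<open>n\<close> and the safe ones depth at most \<open>m\<close>, all
  innermost derivations have length at most \<open>b n\<close> and all results have depth at most \<open>b n + m\<close>.
  A recursive call contributes additively to both bounds, and the recursion is not longer than the
  number of multisets of bounded size over \<open>{..n}\<close>, which is polynomial in \<open>n\<close>.
\<close>

section \<open>Polynomials over the natural numbers\<close>

lemma poly_nat_mono:
  fixes p :: "nat poly"
  assumes "x \<le> y"
  shows "poly p x \<le> poly p y"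
  by (induction p) (use assms in \<open>auto intro!: add_mono mult_mono\<close>)

lemma poly_sum_list: "poly (sum_list ps) x = (\<Sum>p\<leftarrow>ps. poly p x)"
  for x :: "'a :: comm_semiring_0"
  by (induction ps) auto

text \<open>Natural coefficients are nonnegative, so the sum of a finite family of polynomials
  dominates each member. Sums therefore serve throughout in place of maxima, which need not be
  polynomials.\<close>

lemma poly_le_sum_nat:
  fixes p :: "'a \<Rightarrow> nat poly"
  assumes "finite A" "a \<in> A"
  shows "poly (p a) x \<le> poly (sum p A) x"
  unfolding poly_sum by (rule member_le_sum) (use assms in auto)

section \<open>Bounds on innermost derivations\<close>

text \<open>
  The depth of a normal form: a term whose root is a defined symbol matches no constructor
  pattern, so that a stuck subterm acts like a constant.
\<close>

fun nf_depth :: "'f set \<Rightarrow> ('f, 'v) term \<Rightarrow> nat" where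
  "nf_depth D (Var x) = 1"
| "nf_depth D (Fun f ts) = (if f \<in> D then 1 else 1 + Max ({0} \<union> nf_depth D ` set ts))"

lemma nf_depth_eq_depth: "funs_term t \<inter> D = {} \<Longrightarrow> nf_depth D t = depth t"
proof (induction t)
  case (Fun f ts)
  then have "nf_depth D ` set ts = depth ` set ts"
    by (intro image_cong) auto
  with Fun.prems show ?case by simp
qed simp

lemma depth_le_term_size: "depth t \<le> term_size t"
proof (induction t)
  case (Fun f ts)
  have "depth t \<le> sum_list (map term_size ts)" if "t \<in> set ts" for t
    using Fun.IH[OF that] member_le_sum_list[of "term_size t" "map term_size ts"] that
    by fastforce
  then show ?case by auto
qed simp

text \<open>Joint invariant of all innermost derivations from \<open>s\<close>: \<open>n\<close> is
  a budget of steps, and \<open>d\<close> bounds \<open>nf_depth\<close> of every normal form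
  reached. Both are tracked together because the cost of a call depends on the depth of its
  evaluated arguments.\<close>

primrec eval_bound :: "'f set \<Rightarrow> ('f, 'v) trs \<Rightarrow> nat \<Rightarrow> nat \<Rightarrow> ('f, 'v) term \<Rightarrow> bool" where
  "eval_bound D R d 0 s \<longleftrightarrow>
     (\<nexists>t. istep R s t) \<and> (normal_form R s \<longrightarrow> nf_depth D s \<le> d)"
| "eval_bound D R d (Suc n) s \<longleftrightarrow>
     (\<forall>t. istep R s t \<longrightarrow> eval_bound D R d n t) \<and> (normal_form R s \<longrightarrow> nf_depth D s \<le> d)"

lemma eval_bound_mono:
  assumes "eval_bound D R d n s" "d \<le> d'" "n \<le> n'"
  shows "eval_bound D R d' n' s"
  using assms
proof (induction n' arbitrary: n s)
  case (Suc n')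
  then show ?case by (cases n) auto
qed auto

lemma eval_boundI:
  assumes "\<And>t. istep R s t \<Longrightarrow> \<exists>k. n = Suc k \<and> eval_bound D R d k t"
    and "normal_form R s \<Longrightarrow> nf_depth D s \<le> d"
  shows "eval_bound D R d n s"
  using assms by (cases n) auto

lemma eval_bound_nf: "eval_bound D R d n s \<Longrightarrow> normal_form R s \<Longrightarrow> nf_depth D s \<le> d"
  by (cases n) auto

lemma istep_imp_rstep: "istep R s t \<Longrightarrow> rstep R s t"
  by (induction rule: istep.induct) (metis rstep.root, rule rstep.arg)

lemma eval_bound_normal_form:
  assumes "normal_form R s" "nf_depth D s \<le> d"
  shows "eval_bound D R d n s"
  using assms istep_imp_rstep[of R s] unfolding normal_form_def by (cases n) auto

lemma eval_bound_step:
  assumes "eval_bound D R d n s" "istep R s t"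
  obtains n' where "n = Suc n'" "eval_bound D R d n' t"
  using assms by (cases n) auto

lemma eval_bound_length:
  assumes "eval_bound D R d n s" "(istep R ^^ k) s t"
  shows "k \<le> n"
  using assms
proof (induction k arbitrary: n s)
  case (Suc k)
  then obtain u where "istep R s u" "(istep R ^^ k) u t"
    by (metis relpowp_Suc_D2)
  with Suc show ?case by (metis eval_bound_step Suc_le_mono)
qed simp

lemma derivation_height_le:
  assumes "eval_bound D R d n s"
  shows "derivation_height R s \<le> enat n"
  unfolding derivation_height_def using eval_bound_length[OF assms] by (intro SUP_least) auto

lemma normal_form_arg:
  assumes "normal_form R (Fun f ts)" "t \<in> set ts"
  shows "normal_form R t"
  using assms unfolding normal_form_def by (metis rstep.arg split_list)

lemma normal_form_subst_var:
  assumes "normal_form R (subst t \<sigma>)" "x \<in> vars_term t"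
  shows "normal_form R (\<sigma> x)"
  using assms
proof (induction t)
  case (Fun f ts)
  then obtain t where "t \<in> set ts" "x \<in> vars_term t" by auto
  with Fun show ?case using normal_form_arg[of R f "map (\<lambda>t. subst t \<sigma>) ts"] by fastforce
qed simp

text \<open>
  Innermost rewriting contracts the root only after all arguments have reached normal forms, so the
  lengths of the derivations of the arguments add up.
\<close>

lemma eval_bound_Fun:
  assumes "length ns = length ts"
    and "\<And>i. i < length ts \<Longrightarrow> eval_bound D R (d i) (ns ! i) (ts ! i)"
    and "\<And>ws. \<lbrakk>length ws = length ts; \<forall>w\<in>set ws. normal_form R w;
           \<forall>i<length ts. nf_depth D (ws ! i) \<le> d i\<rbrakk> \<Longrightarrow> eval_bound D R e n (Fun g ws)"
  shows "eval_bound D R e (sum_list ns + n) (Fun g ts)"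
  using assms
\<comment> \<open>The measure is the total budget of the arguments. While some argument is
  reducible, only a step inside an argument is possible, and it lowers one entry of
  \<open>ns\<close> by one.\<close>
proof (induction "sum_list ns" arbitrary: ns ts rule: less_induct)
  case less
  show ?case
  proof (cases "\<forall>t\<in>set ts. normal_form R t")
    case True
    then have "eval_bound D R e n (Fun g ts)"
      using less.prems eval_bound_nf by (metis nth_mem)
    then show ?thesis by (rule eval_bound_mono) auto
  next
    case False
    then have not_nf: "\<not> normal_form R (Fun g ts)"
      using normal_form_arg by metis
    have step: "\<exists>k. sum_list ns + n = Suc k \<and> eval_bound D R e k u" if "istep R (Fun g ts) u" for u
      using that
    proof cases
      case (root l r \<sigma>)
      with False show ?thesis by blast
    next
      case (arg s t us vs)
      let ?i = "length us"
      have i: "?i < length ts" "ts ! ?i = s" using arg by auto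
      obtain k where k: "ns ! ?i = Suc k" "eval_bound D R (d ?i) k t"
        using less.prems(2)[OF i(1)] arg i(2) by (metis eval_bound_step)
      let ?ns = "ns[?i := k]" and ?ts = "us @ t # vs"
      have split: "ns = take ?i ns @ Suc k # drop (Suc ?i) ns"
        using i(1) less.prems(1) k(1) by (metis id_take_nth_drop)
      have upd: "?ns = take ?i ns @ k # drop (Suc ?i) ns"
        using i(1) less.prems(1) by (simp add: upd_conv_take_nth_drop)
      have sum: "sum_list ns = Suc (sum_list ?ns)"
        by (subst split, subst upd) simp
      have "eval_bound D R e (sum_list ?ns + n) (Fun g ?ts)"
      proof (rule less.hyps)
        show "sum_list ?ns < sum_list ns" using sum by simp
        show "length ?ns = length ?ts" using less.prems(1) arg by simp
        show "eval_bound D R (d j) (?ns ! j) (?ts ! j)" if "j < length ?ts" for j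
        proof (cases "j = ?i")
          case True
          with k i less.prems(1) show ?thesis by simp
        next
          case False
          then have "?ts ! j = ts ! j" using arg by (auto simp: nth_append nth_Cons split: nat.split)
          with False that less.prems(2)[of j] arg show ?thesis by simp
        qed
        show "eval_bound D R e n (Fun g ws)"
          if "length ws = length ?ts" "\<forall>w\<in>set ws. normal_form R w"
            "\<forall>i<length ?ts. nf_depth D (ws ! i) \<le> d i" for ws
          using less.prems(3)[of ws] that arg by simp
      qed
      with sum arg show ?thesis by auto
    qed
    show ?thesis by (rule eval_boundI) (use step not_nf in auto)
  qed
qed

section \<open>Multisets of bounded size\<close>

lemma rel_mset_elem:
  assumes "rel_mset eq M N" "y \<in># N"
  shows "\<exists>x\<in>#M. eq x y"
proof -
  obtain xs ys where "mset xs = M" "mset ys = N" and eq: "list_all2 eq xs ys"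
    using assms(1) unfolding rel_mset_def by blast
  moreover obtain i where "i < length ys" "y = ys ! i"
    using assms(2) \<open>mset ys = N\<close> by (auto simp: in_set_conv_nth)
  ultimately show ?thesis
    using list_all2_nthD2[OF eq] list_all2_lengthD[OF eq] nth_mem by fastforce
qed

lemma mul_gt_elem:
  assumes "mul_gt eq gt M N" "y \<in># N"
  shows "\<exists>x\<in>#M. gt x y \<or> eq x y"
proof -
  obtain K K' X Y where "M = K + X" "N = K' + Y" "rel_mset eq K K'" "\<forall>y\<in>#Y. \<exists>x\<in>#X. gt x y"
    using assms(1) unfolding mul_gt_def by blast
  with assms(2) show ?thesis using rel_mset_elem[of eq K K' y] by auto
qed

lemma mul_ge_elem:
  assumes "mul_ge eq gt M N" "y \<in># N"
  shows "\<exists>x\<in>#M. gt x y \<or> eq x y"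
  using assms mul_gt_elem[of eq gt M N] rel_mset_elem[of eq M N] unfolding mul_ge_def by blast

text \<open>Since \<open>h\<close> is constant along \<open>eq\<close>, the kept parts
  \<open>K\<close> and \<open>K'\<close> have the same image, and what remains is one step of the
  ordinary multiset order. The conditions on \<open>h\<close> are restricted to \<open>x\<close> in
  \<open>M\<close> because depth is known to decrease only from values.\<close>

lemma mul_gt_image_less:
  fixes h :: "'a \<Rightarrow> 'b :: preorder"
  assumes "mul_gt eq gt M N"
    and "\<And>x y. x \<in># M \<Longrightarrow> gt x y \<Longrightarrow> h y < h x"
    and "\<And>x y. x \<in># M \<Longrightarrow> eq x y \<Longrightarrow> h y = h x"
  shows "image_mset h N < image_mset h M"
proof -
  obtain K K' X Y where *: "M = K + X" "N = K' + Y" "rel_mset eq K K'" "X \<noteq> {#}"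
    "\<forall>y\<in>#Y. \<exists>x\<in>#X. gt x y"
    using assms(1) unfolding mul_gt_def by blast
  obtain xs ys where xy: "mset xs = K" "mset ys = K'" "list_all2 eq xs ys"
    using *(3) unfolding rel_mset_def by blast
  have "map h ys = map h xs"
  proof (rule nth_equalityI)
    show "length (map h ys) = length (map h xs)" using xy(3) by (simp add: list_all2_lengthD)
    show "map h ys ! i = map h xs ! i" if "i < length (map h ys)" for i
      using that xy assms(3)[of "xs ! i" "ys ! i"] *(1)
      by (auto simp: list_all2_conv_all_nth)
  qed
  then have "image_mset h K' = image_mset h K"
    using xy(1,2) by (metis mset_map)
  moreover have "\<forall>b\<in>#image_mset h Y. \<exists>a\<in>#image_mset h X. b < a"
    using *(1,5) assms(2) by (auto, blast)
  then have "multp (<) (image_mset h K + image_mset h Y) (image_mset h K + image_mset h X)"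
    using *(4) by (intro one_step_implies_multp) auto
  ultimately show ?thesis
    using *(1,2) by (simp add: less_multiset_def)
qed

definition bounded_msets :: "nat \<Rightarrow> nat \<Rightarrow> nat multiset set" where
  "bounded_msets k n = {M. size M \<le> k \<and> set_mset M \<subseteq> {..n}}"

lemma bounded_msets_subset: "bounded_msets k n \<subseteq> mset ` {xs. set xs \<subseteq> {..n} \<and> length xs \<le> k}"
proof
  fix M assume "M \<in> bounded_msets k n"
  moreover obtain xs where "mset xs = M" using ex_mset by blast
  ultimately show "M \<in> mset ` {xs. set xs \<subseteq> {..n} \<and> length xs \<le> k}"
    unfolding bounded_msets_def by auto
qed

lemma finite_bounded_msets: "finite (bounded_msets k n)"
  using bounded_msets_subset by (rule finite_subset) (simp add: finite_lists_length_le)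

text \<open>Each multiset is represented by some list. Counting lists overcounts, but stays
  polynomial in \<open>n\<close> for fixed \<open>k\<close>.\<close>

lemma card_bounded_msets: "card (bounded_msets k n) \<le> (\<Sum>i\<le>k. Suc n ^ i)"
proof -
  let ?L = "{xs. set xs \<subseteq> {..n} \<and> length xs \<le> k}"
  have fin: "finite ?L" by (simp add: finite_lists_length_le)
  have "card (bounded_msets k n) \<le> card (mset ` ?L)"
    using fin bounded_msets_subset by (intro card_mono) auto
  also have "\<dots> \<le> card ?L" using fin by (rule card_image_le)
  also have "\<dots> = (\<Sum>i\<le>k. Suc n ^ i)" by (simp add: card_lists_length_le)
  finally show ?thesis .
qed

text \<open>Turns the well-founded multiset order into a numerical recursion depth. With entries at
  most \<open>n\<close> and size at most \<open>k\<close>, the rank is polynomial in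
  \<open>n\<close>.\<close>

definition mset_rank :: "nat \<Rightarrow> nat \<Rightarrow> nat multiset \<Rightarrow> nat" where
  "mset_rank k n M = card {N \<in> bounded_msets k n. N < M}"

lemma mset_rank_less:
  assumes "N < M" "N \<in> bounded_msets k n"
  shows "mset_rank k n N < mset_rank k n M"
  unfolding mset_rank_def
proof (rule psubset_card_mono)
  show "finite {N \<in> bounded_msets k n. N < M}" using finite_bounded_msets by simp
  \<comment> \<open>The inclusion is strict because \<open>N\<close> belongs to the right set but
    not to the left one.\<close>
  show "{N' \<in> bounded_msets k n. N' < N} \<subset> {N \<in> bounded_msets k n. N < M}"
    using assms by (auto intro: less_trans)
qed

lemma mset_rank_le: "mset_rank k n M \<le> (\<Sum>i\<le>k. Suc n ^ i)"
proof -
  have "mset_rank k n M \<le> card (bounded_msets k n)"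
    unfolding mset_rank_def using finite_bounded_msets by (intro card_mono) auto
  then show ?thesis using card_bounded_msets by (rule le_trans)
qed

section \<open>Terms below a value\<close>

lemma nf_depth_arg:
  assumes "f \<notin> D" "t \<in> set ts"
  shows "nf_depth D t < nf_depth D (Fun f ts)"
proof -
  have "nf_depth D t \<le> Max ({0} \<union> nf_depth D ` set ts)"
    using assms(2) by (intro Max_ge) auto
  with assms(1) show ?thesis by simp
qed

text \<open>Admissibility keeps equivalent symbols among the constructors. Below them only the order
  of the arguments changes, which a maximum of depths does not see.\<close>

lemma safe_eq_value:
  assumes "safe_eq safe P s t" "admissible D P" "funs_term s \<inter> D = {}"
  shows "funs_term t \<inter> D = {} \<and> vars_term t \<subseteq> vars_term s \<and>
    nf_depth D (subst t \<sigma>) = nf_depth D (subst s \<sigma>)"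
  using assms(1,3)
proof (induction rule: safe_eq.induct)
  case (perm f g ss ts \<pi>)
  let ?n = "length ss"
  have IH: "funs_term (ts ! \<pi> i) \<inter> D = {} \<and> vars_term (ts ! \<pi> i) \<subseteq> vars_term (ss ! i) \<and>
      nf_depth D (subst (ts ! \<pi> i) \<sigma>) = nf_depth D (subst (ss ! i) \<sigma>)" if "i < ?n" for i
  proof -
    have "funs_term (ss ! i) \<subseteq> funs_term (Fun f ss)" using nth_mem[OF that] by auto
    then have "funs_term (ss ! i) \<inter> D = {}" using perm.prems by blast
    with perm.IH that show ?thesis by blast
  qed
  \<comment> \<open>Surjectivity of \<open>\<pi>\<close> reindexes the arguments of the right term
    by the positions of the left one.\<close>
  have set_ts: "set ts = (\<lambda>i. ts ! \<pi> i) ` {..<?n}"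
  proof -
    have "set ts = (!) ts ` {..<?n}"
      unfolding perm.hyps(2) by (auto simp: set_conv_nth)
    also have "{..<?n} = \<pi> ` {..<?n}"
      using perm.hyps(3) by (simp add: permutes_image)
    finally show ?thesis by (simp only: image_image)
  qed
  have set_ss: "set ss = (!) ss ` {..<?n}"
    by (auto simp: set_conv_nth)
  have g: "f \<notin> D" "g \<notin> D"
    using perm.hyps(1) perm.prems assms(2) unfolding admissible_def by auto
  have "nf_depth D ` (\<lambda>t. subst t \<sigma>) ` set ts = nf_depth D ` (\<lambda>t. subst t \<sigma>) ` set ss"
    unfolding set_ts set_ss image_image by (rule image_cong) (use IH in auto)
  then have "nf_depth D (subst (Fun g ts) \<sigma>) = nf_depth D (subst (Fun f ss) \<sigma>)"
    using g by simp
  moreover have "funs_term (Fun g ts) \<inter> D = {}"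
    using g IH unfolding set_ts by (auto simp: set_ts)
  moreover have "vars_term (Fun g ts) \<subseteq> vars_term (Fun f ss)"
    using IH by (auto simp: set_ts set_ss)
  ultimately show ?case by blast
qed auto

lemma below_arg:
  assumes "i < length ss" "f \<notin> D"
    and "vars_term t \<subseteq> vars_term (ss ! i)"
    and "nf_depth D (subst t \<sigma>) \<le> nf_depth D (subst (ss ! i) \<sigma>)"
  shows "vars_term t \<subseteq> vars_term (Fun f ss)"
    and "nf_depth D (subst t \<sigma>) < nf_depth D (subst (Fun f ss) \<sigma>)"
proof -
  have i: "ss ! i \<in> set ss" using assms(1) by simp
  with assms(3) show "vars_term t \<subseteq> vars_term (Fun f ss)" by auto
  have "nf_depth D (subst (ss ! i) \<sigma>) < nf_depth D (subst (Fun f ss) \<sigma>)"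
    using i nf_depth_arg[OF assms(2), of "subst (ss ! i) \<sigma>" "map (\<lambda>t. subst t \<sigma>) ss"] by simp
  with assms(4) show "nf_depth D (subst t \<sigma>) < nf_depth D (subst (Fun f ss) \<sigma>)" by simp
qed

text \<open>The clauses \<open>prec\<close> and \<open>mul\<close> require a defined root, so on
  values the order is the proper subterm relation modulo \<open>safe_eq\<close>. Every constructor
  passed on the way down costs at least one level of depth.\<close>

lemma pop_gt_value:
  assumes "pop_gt D safe P s t" "admissible D P" "funs_term s \<inter> D = {}"
  shows "funs_term t \<inter> D = {} \<and> vars_term t \<subseteq> vars_term s \<and>
    nf_depth D (subst t \<sigma>) < nf_depth D (subst s \<sigma>)"
  using assms(1,3)
proof (induction rule: pop_gt.induct)
  case (arg i ss t f)
  have "funs_term (ss ! i) \<subseteq> funs_term (Fun f ss)" using nth_mem[OF arg.hyps(1)] by auto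
  with arg.prems have f: "f \<notin> D" and val: "funs_term (ss ! i) \<inter> D = {}" by auto
  have *: "funs_term t \<inter> D = {} \<and> vars_term t \<subseteq> vars_term (ss ! i) \<and>
      nf_depth D (subst t \<sigma>) \<le> nf_depth D (subst (ss ! i) \<sigma>)"
  proof (cases "safe_eq safe P (ss ! i) t")
    case True
    show ?thesis using safe_eq_value[OF True assms(2) val, of \<sigma>] by simp
  next
    case False
    then show ?thesis using arg.IH val by (simp add: less_imp_le)
  qed
  then show ?case using below_arg[OF arg.hyps(1) f, of t \<sigma>] by simp
qed auto

lemma sq_gt_value:
  assumes "sq_gt D safe P s t" "admissible D P" "funs_term s \<inter> D = {}"
  shows "funs_term t \<inter> D = {} \<and> vars_term t \<subseteq> vars_term s \<and>
    nf_depth D (subst t \<sigma>) < nf_depth D (subst s \<sigma>)"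
  using assms(1,3)
proof (induction rule: sq_gt.induct)
  case (arg i ss f t)
  have "funs_term (ss ! i) \<subseteq> funs_term (Fun f ss)" using nth_mem[OF arg.hyps(1)] by auto
  with arg.prems have f: "f \<notin> D" and val: "funs_term (ss ! i) \<inter> D = {}" by auto
  have *: "funs_term t \<inter> D = {} \<and> vars_term t \<subseteq> vars_term (ss ! i) \<and>
      nf_depth D (subst t \<sigma>) \<le> nf_depth D (subst (ss ! i) \<sigma>)"
  proof (cases "safe_eq safe P (ss ! i) t")
    case True
    show ?thesis using safe_eq_value[OF True assms(2) val, of \<sigma>] by simp
  next
    case False
    then show ?thesis using arg.IH val by (simp add: less_imp_le)
  qed
  then show ?case using below_arg[OF arg.hyps(1) f, of t \<sigma>] by simp
qed auto

section \<open>Polynomial bounds for predicative recursion\<close>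

locale predicative_trs =
  fixes ar :: "'f :: finite \<Rightarrow> nat" and D :: "'f set" and R :: "('f, 'v) trs"
    and safe :: "'f \<Rightarrow> nat set" and P :: "'f rel"
  assumes constructor: "constructor_trs ar D R"
    and via: "predicative_recursive_via ar D R safe P"
begin

lemma admissible: "admissible D P"
  and precedence: "preorder_on UNIV P"
  and safe: "safe_mapping ar D safe"
  using via unfolding predicative_recursive_via_def by auto

lemma P_refl: "(f, f) \<in> P"
  using precedence unfolding preorder_on_def by (meson UNIV_I reflpE refl_onD)

lemma P_trans: "(f, g) \<in> P \<Longrightarrow> (g, h) \<in> P \<Longrightarrow> (f, h) \<in> P"
  using precedence unfolding preorder_on_def trans_def by blast

text \<open>The signature is finite and the strict part of a preorder is transitive and irreflexive,
  hence acyclic.\<close>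

lemma wf_prec_gt: "wf {(g, f). prec_gt P f g}"
proof (rule finite_acyclic_wf)
  have trans: "trans {(g, f). prec_gt P f g}"
    unfolding trans_def prec_gt_def by (blast intro: P_trans)
  show "acyclic {(g, f). prec_gt P f g}"
    unfolding acyclic_def trancl_id[OF trans] by (simp add: prec_gt_def)
qed simp

lemma rule_root:
  assumes "(l, r) \<in> R"
  obtains f ss where "l = Fun f ss" "f \<in> D" "\<forall>s\<in>set ss. funs_term s \<inter> D = {}"
proof -
  have "is_basic ar D l" using assms constructor unfolding constructor_trs_def by blast
  then show ?thesis using that unfolding is_basic_def is_value_def by blast
qed

lemma rule_rhs:
  assumes "(l, r) \<in> R"
  shows "wf_term ar r" "pop_gt D safe P l r"
  using assms constructor via
  unfolding constructor_trs_def is_trs_def predicative_recursive_via_def by auto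

section \<open>Normal forms built from constructors\<close>

lemma normal_form_Var: "normal_form R (Var x)"
  unfolding normal_form_def
proof
  assume "\<exists>t. rstep R (Var x) t"
  then obtain l r \<sigma> where "(l, r) \<in> R" "subst l \<sigma> = Var x"
    by (auto elim: rstep.cases)
  then show False by (auto elim: rule_root)
qed

lemma normal_form_constructor:
  assumes "f \<notin> D" "\<forall>t\<in>set ts. normal_form R t"
  shows "normal_form R (Fun f ts)"
  unfolding normal_form_def
proof
  assume "\<exists>t. rstep R (Fun f ts) t"
  then obtain t where "rstep R (Fun f ts) t" ..
  then show False
  proof cases
    case (root l r \<sigma>)
    then show False using assms(1) by (auto elim: rule_root)
  next
    case (arg s t us vs)
    then show False using assms(2) unfolding normal_form_def by auto
  qed
qed

lemma normal_form_value_subst: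
  assumes "funs_term t \<inter> D = {}" "\<forall>x\<in>vars_term t. normal_form R (\<sigma> x)"
  shows "normal_form R (subst t \<sigma>)"
  using assms
proof (induction t)
  case (Fun f ts)
  then have "f \<notin> D" "\<forall>t\<in>set ts. normal_form R (subst t \<sigma>)" by fastforce+
  then show ?case using normal_form_constructor by simp
qed simp

lemma normal_form_value:
  assumes "funs_term t \<inter> D = {}"
  shows "normal_form R t"
  using assms
proof (induction t)
  case (Fun f ts)
  then have "f \<notin> D" "\<forall>t\<in>set ts. normal_form R t" by fastforce+
  then show ?case using normal_form_constructor by simp
qed (simp add: normal_form_Var)

section \<open>Bounds for calls whose arguments are normal forms\<close>

definition args_depth :: "'f \<Rightarrow> ('f, 'v) term list \<Rightarrow> nat \<Rightarrow> nat \<Rightarrow> bool" where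
  "args_depth f ts n m \<longleftrightarrow>
     (\<forall>i<length ts. nf_depth D (ts ! i) \<le> (if i \<in> safe f then m else n))"

text \<open>The safe depth \<open>m\<close> enters the depth of the result with coefficient one and
  the length not at all. Nesting calls in safe positions thus adds bounds instead of composing
  them.\<close>

definition bounding :: "nat poly \<Rightarrow> 'f \<Rightarrow> bool" where
  "bounding b f \<longleftrightarrow>
     (\<forall>ts n m. length ts = ar f \<longrightarrow> (\<forall>t\<in>set ts. normal_form R t) \<longrightarrow> args_depth f ts n m \<longrightarrow>
        eval_bound D R (poly b n + m) (poly b n) (Fun f ts))"

text \<open>All positions of a constructor are safe, so building the term takes no step and raises
  the safe depth by one.\<close>

lemma bounding_constructor:
  assumes "f \<notin> D"
  shows "bounding 1 f"
  unfolding bounding_def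
proof (intro allI impI)
  fix ts :: "('f, 'v) term list" and n m
  assume len: "length ts = ar f" and nf: "\<forall>t\<in>set ts. normal_form R t"
    and depth: "args_depth f ts n m"
  have "safe f = {..<ar f}"
    using safe assms unfolding safe_mapping_def by blast
  with depth len have "nf_depth D t \<le> m" if "t \<in> set ts" for t
    using that unfolding args_depth_def by (auto simp: in_set_conv_nth)
  then have "nf_depth D (Fun f ts) \<le> 1 + m"
    using assms by simp
  then show "eval_bound D R (poly 1 n + m) (poly 1 n) (Fun f ts)"
    using normal_form_constructor[OF assms nf] by (intro eval_bound_normal_form) auto
qed

lemma bounding_mono:
  assumes "bounding b f" "\<And>n. poly b n \<le> poly b' n"
  shows "bounding b' f"
  unfolding bounding_def
proof (intro allI impI)
  fix ts :: "('f, 'v) term list" and n m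
  assume "length ts = ar f" "\<forall>t\<in>set ts. normal_form R t" "args_depth f ts n m"
  then have "eval_bound D R (poly b n + m) (poly b n) (Fun f ts)"
    using assms(1) unfolding bounding_def by blast
  then show "eval_bound D R (poly b' n + m) (poly b' n) (Fun f ts)"
    by (rule eval_bound_mono) (use assms(2) in auto)
qed

text \<open>Call by value: the arguments are first evaluated within the depth limits of their
  positions, and then \<open>bounding\<close> applies to the resulting normal forms.\<close>

lemma bounding_call:
  assumes "bounding b g" "length ts = ar g" "length ns = length ts"
    and "\<And>i. i < length ts \<Longrightarrow>
      eval_bound D R (if i \<in> safe g then m else n) (ns ! i) (ts ! i)"
  shows "eval_bound D R (poly b n + m) (sum_list ns + poly b n) (Fun g ts)"
proof (rule eval_bound_Fun[where d = "\<lambda>i. if i \<in> safe g then m else n"])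
  fix ws :: "('f, 'v) term list"
  assume "length ws = length ts" "\<forall>w\<in>set ws. normal_form R w"
    "\<forall>i<length ts. nf_depth D (ws ! i) \<le> (if i \<in> safe g then m else n)"
  then show "eval_bound D R (poly b n + m) (poly b n) (Fun g ws)"
    using assms(1,2) unfolding bounding_def args_depth_def by simp
qed (use assms(3,4) in auto)

section \<open>Bounds for instantiated right-hand sides\<close>

definition normal_depths :: "'f \<Rightarrow> ('f, 'v) term list \<Rightarrow> nat multiset" where
  "normal_depths f ts = image_mset (nf_depth D) (mset (normal_args safe f ts))"

text \<open>Describes the substitutions that arise when an innermost redex with root
  \<open>f\<close> is matched.\<close>

definition nf_instance :: "'f \<Rightarrow> ('f, 'v) term list \<Rightarrow> ('v \<Rightarrow> ('f, 'v) term) \<Rightarrow> nat \<Rightarrow> nat \<Rightarrow> bool" where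
  "nf_instance f ss \<sigma> n m \<longleftrightarrow>
     (\<forall>x\<in>vars_term (Fun f ss). normal_form R (\<sigma> x)) \<and>
     args_depth f (map (\<lambda>s. subst s \<sigma>) ss) n m"

lemma value_instance:
  assumes "nf_instance f ss \<sigma> n m" "i < length ss"
    and "funs_term t \<inter> D = {} \<and> vars_term t \<subseteq> vars_term (ss ! i) \<and>
      nf_depth D (subst t \<sigma>) \<le> nf_depth D (subst (ss ! i) \<sigma>)"
  shows "normal_form R (subst t \<sigma>)"
    and "nf_depth D (subst t \<sigma>) \<le> (if i \<in> safe f then m else n)"
proof -
  have "ss ! i \<in> set ss" using assms(2) by simp
  then have "vars_term t \<subseteq> vars_term (Fun f ss)" using assms(3) by auto
  then show "normal_form R (subst t \<sigma>)"
    using assms(1,3) unfolding nf_instance_def by (intro normal_form_value_subst) auto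
  have "nf_depth D (subst (ss ! i) \<sigma>) \<le> (if i \<in> safe f then m else n)"
    using assms(1,2) unfolding nf_instance_def args_depth_def by (metis length_map nth_map)
  with assms(3) show "nf_depth D (subst t \<sigma>) \<le> (if i \<in> safe f then m else n)"
    by linarith
qed

text \<open>Neither bound mentions \<open>m\<close> or a recursive call, which is why such terms may
  be placed in normal positions. The polynomial is chosen before the substitution and the
  depths.\<close>

definition sq_bounded :: "'f \<Rightarrow> ('f, 'v) term list \<Rightarrow> nat poly \<Rightarrow> ('f, 'v) term \<Rightarrow> bool" where
  "sq_bounded f ss e t \<longleftrightarrow>
     (\<forall>\<sigma> n m. nf_instance f ss \<sigma> n m \<longrightarrow> eval_bound D R (poly e n) (poly e n) (subst t \<sigma>))"

lemma sq_gt_bounded: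
  assumes f: "f \<in> D" "\<forall>s\<in>set ss. funs_term s \<inter> D = {}"
    and b: "\<And>g. prec_gt P f g \<Longrightarrow> bounding b g"
    and "sq_gt D safe P (Fun f ss) t" "wf_term ar t"
  shows "\<exists>e. sq_bounded f ss e t"
  using assms(4,5)
proof (induction "Fun f ss" t rule: sq_gt.induct)
  case (arg i t)
  have val: "funs_term (ss ! i) \<inter> D = {}" using f(2) arg.hyps(1) by simp
  \<comment> \<open>\<open>[:0, 1:]\<close> is the identity polynomial. Position \<open>i\<close> is
    normal because \<open>f\<close> is defined, so the instance has depth at most
    \<open>n\<close>.\<close>
  have "sq_bounded f ss [:0, 1:] t"
    unfolding sq_bounded_def
  proof (intro allI impI)
    fix \<sigma> n m assume inst: "nf_instance f ss \<sigma> n m"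
    have "funs_term t \<inter> D = {} \<and> vars_term t \<subseteq> vars_term (ss ! i) \<and>
        nf_depth D (subst t \<sigma>) \<le> nf_depth D (subst (ss ! i) \<sigma>)"
    proof (cases "safe_eq safe P (ss ! i) t")
      case True
      show ?thesis using safe_eq_value[OF True admissible val, of \<sigma>] by simp
    next
      case False
      with arg.hyps(3) have "sq_gt D safe P (ss ! i) t" by blast
      from sq_gt_value[OF this admissible val, of \<sigma>] show ?thesis by simp
    qed
    from value_instance[OF inst arg.hyps(1) this] arg.hyps(2) f(1)
    show "eval_bound D R (poly [:0, 1:] n) (poly [:0, 1:] n) (subst t \<sigma>)"
      by (intro eval_bound_normal_form) auto
  qed
  then show ?case ..
next
  case (prec g ts)
  then have "\<forall>t\<in>set ts. \<exists>e. sq_bounded f ss e t" by simp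
  then obtain et where et: "\<And>t. t \<in> set ts \<Longrightarrow> sq_bounded f ss (et t) t" by metis
  define e where "e = sum_list (map et ts)"
  have le: "poly (et t) n \<le> poly e n" if "t \<in> set ts" for t n
    unfolding e_def poly_sum_list by (rule member_le_sum_list) (use that in auto)
  have "sq_bounded f ss (e + pcompose b e) (Fun g ts)"
    unfolding sq_bounded_def
  proof (intro allI impI)
    fix \<sigma> n m assume inst: "nf_instance f ss \<sigma> n m"
    let ?ns = "map (\<lambda>t. poly (et t) n) ts"
    \<comment> \<open>The safe depth of the call is also taken to be \<open>poly e n\<close>, so
      that \<open>m\<close> disappears from the bound.\<close>
    have "eval_bound D R (poly b (poly e n) + poly e n) (sum_list ?ns + poly b (poly e n))
        (Fun g (map (\<lambda>t. subst t \<sigma>) ts))"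
    proof (rule bounding_call)
      show "bounding b g" using b prec.hyps(2) .
      show "length (map (\<lambda>t. subst t \<sigma>) ts) = ar g" using prec.prems by simp
      show "eval_bound D R (if i \<in> safe g then poly e n else poly e n) (?ns ! i)
          (map (\<lambda>t. subst t \<sigma>) ts ! i)" if "i < length (map (\<lambda>t. subst t \<sigma>) ts)" for i
      proof -
        have i: "i < length ts" using that by simp
        then have "eval_bound D R (poly (et (ts ! i)) n) (poly (et (ts ! i)) n) (subst (ts ! i) \<sigma>)"
          using et[of "ts ! i"] inst unfolding sq_bounded_def by (meson nth_mem)
        then have "eval_bound D R (poly e n) (poly (et (ts ! i)) n) (subst (ts ! i) \<sigma>)"
          by (rule eval_bound_mono) (use le i in auto)
        with i show ?thesis by simp
      qed
    qed simp
    moreover have "sum_list ?ns = poly e n"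
      unfolding e_def poly_sum_list by (simp add: comp_def)
    ultimately show "eval_bound D R (poly (e + pcompose b e) n) (poly (e + pcompose b e) n)
        (subst (Fun g ts) \<sigma>)"
      by (simp add: poly_pcompose add.commute)
  qed
  then show ?case ..
qed

text \<open>The induction hypothesis on recursive calls, abstracted to a number \<open>T\<close>.
  Right-hand sides can then be analysed once per rule, before the value of \<open>T\<close> is
  known.\<close>

definition calls_bounded :: "'f \<Rightarrow> nat multiset \<Rightarrow> nat \<Rightarrow> nat \<Rightarrow> nat \<Rightarrow> bool" where
  "calls_bounded f M n m T \<longleftrightarrow>
     (\<forall>g ts. prec_eq P f g \<longrightarrow> length ts = ar g \<longrightarrow> (\<forall>t\<in>set ts. normal_form R t) \<longrightarrow>
        args_depth g ts n m \<longrightarrow> normal_depths g ts < M \<longrightarrow> eval_bound D R (T + m) T (Fun g ts))"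

text \<open>
  The bound \<open>T\<close> of a recursive call enters with coefficient at most one, since at most one safe
  argument of each symbol below \<open>f\<close> may contain such a call.
\<close>

definition pop_bounded :: "'f \<Rightarrow> ('f, 'v) term list \<Rightarrow> nat poly \<Rightarrow> ('f, 'v) term \<Rightarrow> bool" where
  "pop_bounded f ss e t \<longleftrightarrow>
     (\<forall>\<sigma> n m T. nf_instance f ss \<sigma> n m \<longrightarrow>
        calls_bounded f (normal_depths f (map (\<lambda>s. subst s \<sigma>) ss)) n m T \<longrightarrow>
        (let k = poly e n + (if t \<in> terms_below P f then 0 else T)
         in eval_bound D R (k + m) k (subst t \<sigma>)))"

lemma pop_ge_value:
  assumes "pop_gt D safe P s t \<or> safe_eq safe P s t" "funs_term s \<inter> D = {}"
  shows "funs_term t \<inter> D = {} \<and> vars_term t \<subseteq> vars_term s \<and>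
    nf_depth D (subst t \<sigma>) \<le> nf_depth D (subst s \<sigma>)"
  using assms(1)
proof
  assume "pop_gt D safe P s t"
  from pop_gt_value[OF this admissible assms(2), of \<sigma>] show ?thesis by simp
next
  assume "safe_eq safe P s t"
  from safe_eq_value[OF this admissible assms(2), of \<sigma>] show ?thesis by simp
qed

text \<open>The instance is already a normal form. Its depth is at most \<open>n\<close> or at most
  \<open>m\<close>, according to the kind of position \<open>i\<close>, and hence at most
  \<open>n + m\<close>.\<close>

lemma pop_gt_arg_bounded:
  assumes "i < length ss" "funs_term (ss ! i) \<inter> D = {}"
    and "pop_gt D safe P (ss ! i) t \<or> safe_eq safe P (ss ! i) t"
  shows "pop_bounded f ss [:0, 1:] t"
  unfolding pop_bounded_def
proof (intro allI impI)
  fix \<sigma> n m T assume inst: "nf_instance f ss \<sigma> n m"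
  let ?k = "poly [:0, 1:] n + (if t \<in> terms_below P f then 0 else T)"
  have "eval_bound D R (?k + m) ?k (subst t \<sigma>)"
    using value_instance[OF inst assms(1) pop_ge_value[OF assms(3,2)]]
    by (intro eval_bound_normal_form) (auto split: if_splits)
  then show "let k = ?k in eval_bound D R (k + m) k (subst t \<sigma>)" by simp
qed

text \<open>The arguments of such a call are values, so no work precedes it. The call itself is
  covered by \<open>calls_bounded\<close> because its multiset of normal depths is smaller.\<close>

lemma pop_gt_mul_bounded:
  assumes f: "\<forall>s\<in>set ss. funs_term s \<inter> D = {}"
    and g: "prec_eq P f g" "length ts = ar g"
    and normal: "mul_gt (safe_eq safe P) (pop_gt D safe P)
      (mset (normal_args safe f ss)) (mset (normal_args safe g ts))"
    and safe: "mul_ge (safe_eq safe P) (pop_gt D safe P)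
      (mset (safe_args safe f ss)) (mset (safe_args safe g ts))"
  shows "pop_bounded f ss 0 (Fun g ts)"
  unfolding pop_bounded_def
proof (intro allI impI)
  fix \<sigma> n m T
  assume inst: "nf_instance f ss \<sigma> n m"
    and calls: "calls_bounded f (normal_depths f (map (\<lambda>s. subst s \<sigma>) ss)) n m T"
  let ?us = "map (\<lambda>t. subst t \<sigma>) ts"
  \<comment> \<open>Normal arguments are dominated by normal ones and safe by safe ones, so the
    limits \<open>n\<close> and \<open>m\<close> carry over to the call.\<close>
  have ge: "\<exists>i<length ss. (i \<in> safe f \<longleftrightarrow> j \<in> safe g) \<and>
      (pop_gt D safe P (ss ! i) (ts ! j) \<or> safe_eq safe P (ss ! i) (ts ! j))"
    if j: "j < length ts" for j
  proof (cases "j \<in> safe g")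
    case True
    with j have "ts ! j \<in># mset (safe_args safe g ts)"
      unfolding safe_args_def by (auto simp: set_nths)
    from mul_ge_elem[OF safe this] show ?thesis
      using True unfolding safe_args_def by (auto simp: set_nths)
  next
    case False
    with j have "ts ! j \<in># mset (normal_args safe g ts)"
      unfolding normal_args_def by (auto simp: set_nths)
    from mul_gt_elem[OF normal this] show ?thesis
      using False unfolding normal_args_def by (auto simp: set_nths)
  qed
  have args: "normal_form R (?us ! j) \<and> nf_depth D (?us ! j) \<le> (if j \<in> safe g then m else n)"
    if "j < length ts" for j
  proof -
    obtain i where i: "i < length ss" "i \<in> safe f \<longleftrightarrow> j \<in> safe g"
      "pop_gt D safe P (ss ! i) (ts ! j) \<or> safe_eq safe P (ss ! i) (ts ! j)"
      using ge \<open>j < length ts\<close> by blast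
    have "funs_term (ss ! i) \<inter> D = {}" using f i(1) by simp
    from value_instance[OF inst i(1) pop_ge_value[OF i(3) this]] i(2) that
    show ?thesis by simp
  qed
  have "normal_depths g ?us < normal_depths f (map (\<lambda>s. subst s \<sigma>) ss)"
  proof -
    have val: "funs_term s \<inter> D = {}" if "s \<in># mset (normal_args safe f ss)" for s
      using that f unfolding normal_args_def by (auto dest: in_set_nthsD)
    have "image_mset (\<lambda>t. nf_depth D (subst t \<sigma>)) (mset (normal_args safe g ts))
        < image_mset (\<lambda>t. nf_depth D (subst t \<sigma>)) (mset (normal_args safe f ss))"
      using normal
    proof (rule mul_gt_image_less)
      show "nf_depth D (subst y \<sigma>) < nf_depth D (subst x \<sigma>)"
        if "x \<in># mset (normal_args safe f ss)" "pop_gt D safe P x y" for x y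
        using pop_gt_value[OF that(2) admissible val[OF that(1)]] by blast
      show "nf_depth D (subst y \<sigma>) = nf_depth D (subst x \<sigma>)"
        if "x \<in># mset (normal_args safe f ss)" "safe_eq safe P x y" for x y
        using safe_eq_value[OF that(2) admissible val[OF that(1)]] by blast
    qed
    then show ?thesis
      unfolding normal_depths_def normal_args_def nths_map mset_map
      by (simp add: image_mset.compositionality comp_def)
  qed
  moreover have "\<forall>t\<in>set ?us. normal_form R t" "args_depth g ?us n m"
    using args unfolding args_depth_def by (auto simp: in_set_conv_nth)
  ultimately have "eval_bound D R (T + m) T (Fun g ?us)"
    using calls g unfolding calls_bounded_def by simp
  moreover have "Fun g ts \<notin> terms_below P f"
    using g(1) unfolding terms_below_def prec_gt_def prec_eq_def by simp
  ultimately show "let k = poly 0 n + (if Fun g ts \<in> terms_below P f then 0 else T)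
      in eval_bound D R (k + m) k (subst (Fun g ts) \<sigma>)"
    by simp
qed

text \<open>Normal arguments are bounded by \<open>sq_bounded\<close>, so \<open>T\<close> never
  gets inside the polynomial \<open>b\<close>. It arrives only through safe arguments, where it is
  added.\<close>

lemma pop_gt_prec_bounded:
  assumes b: "bounding b g" and g: "prec_gt P f g" "length ts = ar g"
    and normal: "\<And>j. j < length ts \<Longrightarrow> j \<notin> safe g \<Longrightarrow> \<exists>e. sq_bounded f ss e (ts ! j)"
    and safe: "\<And>j. j < length ts \<Longrightarrow> j \<in> safe g \<Longrightarrow> \<exists>e. pop_bounded f ss e (ts ! j)"
    and card: "card {j. j < length ts \<and> j \<in> safe g \<and> ts ! j \<notin> terms_below P f} \<le> 1"
  shows "\<exists>e. pop_bounded f ss e (Fun g ts)"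
proof -
  have "\<exists>e. if j \<in> safe g then pop_bounded f ss e (ts ! j) else sq_bounded f ss e (ts ! j)"
    if "j < length ts" for j
    using normal[OF that] safe[OF that] by (cases "j \<in> safe g") auto
  then obtain et where et: "\<And>j. j < length ts \<Longrightarrow>
      (if j \<in> safe g then pop_bounded f ss (et j) (ts ! j) else sq_bounded f ss (et j) (ts ! j))"
    by metis
  define e where "e = (\<Sum>j<length ts. et j)"
  let ?rec = "\<lambda>j. j \<in> safe g \<and> ts ! j \<notin> terms_below P f"
  have "pop_bounded f ss (e + pcompose b e) (Fun g ts)"
    unfolding pop_bounded_def
  proof (intro allI impI)
    fix \<sigma> n m T
    assume inst: "nf_instance f ss \<sigma> n m"
      and calls: "calls_bounded f (normal_depths f (map (\<lambda>s. subst s \<sigma>) ss)) n m T"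
    let ?us = "map (\<lambda>t. subst t \<sigma>) ts"
    let ?T = "if Fun g ts \<in> terms_below P f then 0 else T"
    define ns where
      "ns = map (\<lambda>j. poly (et j) n + (if ?rec j then T else 0)) [0..<length ts]"
    have le: "poly (et j) n \<le> poly e n" if "j < length ts" for j
      unfolding e_def by (rule poly_le_sum_nat) (use that in auto)
    \<comment> \<open>An argument that is not below \<open>f\<close> makes the whole term not below
      \<open>f\<close>, so \<open>T\<close> is then already counted in \<open>?T\<close>.\<close>
    have rec_le: "(if ?rec j then T else 0) \<le> ?T" if "j < length ts" for j
      using nth_mem[OF that] unfolding terms_below_def by auto
    \<comment> \<open>The cardinality condition of the order enters here: at most one summand equals
      \<open>T\<close>, which prevents its coefficient from growing.\<close>
    have "(\<Sum>j<length ts. if ?rec j then T else 0) = card {j. j < length ts \<and> ?rec j} * T"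
      by (simp add: sum.If_cases Int_def)
    also have "\<dots> \<le> ?T"
    proof (cases "{j. j < length ts \<and> ?rec j} = {}")
      case True
      show ?thesis unfolding True by simp
    next
      case False
      then obtain j where "j < length ts" "?rec j" by blast
      then have "T \<le> ?T" using rec_le[of j] by simp
      with card show ?thesis using mult_le_mono1[OF card, of T] by linarith
    qed
    finally have "sum_list ns \<le> poly e n + ?T"
      unfolding ns_def e_def poly_sum
      by (simp add: interv_sum_list_conv_sum_set_nat atLeast0LessThan sum.distrib)
    moreover have "eval_bound D R (poly b (poly e n) + (poly e n + ?T + m))
        (sum_list ns + poly b (poly e n)) (Fun g ?us)"
    proof (rule bounding_call)
      show "length ?us = ar g" "length ns = length ?us" using g(2) by (auto simp: ns_def)
      show "eval_bound D R (if j \<in> safe g then poly e n + ?T + m else poly e n) (ns ! j) (?us ! j)"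
        if "j < length ?us" for j
      proof -
        have j: "j < length ts" using that by simp
        show ?thesis
        proof (cases "j \<in> safe g")
          case True
          then have "eval_bound D R (poly (et j) n + (if ?rec j then T else 0) + m)
              (poly (et j) n + (if ?rec j then T else 0)) (subst (ts ! j) \<sigma>)"
            using et[OF j] inst calls unfolding pop_bounded_def Let_def by (auto split: if_splits)
          then have "eval_bound D R (poly e n + ?T + m)
              (poly (et j) n + (if ?rec j then T else 0)) (subst (ts ! j) \<sigma>)"
            by (rule eval_bound_mono) (intro add_mono le[OF j] rec_le[OF j] order.refl)+
          with j True show ?thesis unfolding ns_def by simp
        next
          case False
          then have "eval_bound D R (poly (et j) n) (poly (et j) n) (subst (ts ! j) \<sigma>)"
            using et[OF j] inst unfolding sq_bounded_def by auto
          then have "eval_bound D R (poly e n) (poly (et j) n) (subst (ts ! j) \<sigma>)"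
            by (rule eval_bound_mono) (use le[OF j] in auto)
          with j False show ?thesis unfolding ns_def by simp
        qed
      qed
    qed (rule b)
    ultimately show "let k = poly (e + pcompose b e) n + ?T
        in eval_bound D R (k + m) k (subst (Fun g ts) \<sigma>)"
      unfolding Let_def subst.simps by (elim eval_bound_mono) (auto simp: poly_pcompose)
  qed
  then show ?thesis ..
qed

text \<open>The left-hand side stays fixed in \<open>prec\<close>, the one case that recurs on the
  arguments of \<open>t\<close>, so structural induction on \<open>t\<close> suffices.\<close>

lemma pop_gt_bounded:
  assumes f: "f \<in> D" "\<forall>s\<in>set ss. funs_term s \<inter> D = {}"
    and b: "\<And>g. prec_gt P f g \<Longrightarrow> bounding b g"
    and "pop_gt D safe P (Fun f ss) t" "wf_term ar t"
  shows "\<exists>e. pop_bounded f ss e t"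
  using assms(4,5)
proof (induction t rule: term.induct)
  case (Var x)
  from Var.prems(1) show ?case
  proof cases
    case (arg i)
    with f(2) show ?thesis using pop_gt_arg_bounded by (metis nth_mem)
  qed
next
  case (Fun g ts)
  have len: "length ts = ar g" and wf: "\<And>t. t \<in> set ts \<Longrightarrow> wf_term ar t"
    using Fun.prems(2) by auto
  from Fun.prems(1) show ?case
  proof cases
    case (arg i)
    with f(2) show ?thesis using pop_gt_arg_bounded by (metis nth_mem)
  next
    case prec
    show ?thesis
    proof (rule pop_gt_prec_bounded)
      show "bounding b g" using b prec(2) .
      show "\<exists>e. sq_bounded f ss e (ts ! j)" if "j < length ts" "j \<notin> safe g" for j
        using sq_gt_bounded[OF f b] prec(3) wf that by simp
      show "\<exists>e. pop_bounded f ss e (ts ! j)" if "j < length ts" "j \<in> safe g" for j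
        using Fun.IH prec(4) wf that by simp
    qed (use prec len in auto)
  next
    case mul
    then show ?thesis using pop_gt_mul_bounded[OF f(2) _ len] by blast
  qed
qed

section \<open>Unfolding the recursion and induction along the precedence\<close>

lemma normal_depths_bounded:
  assumes "args_depth f ts n m" "length ts \<le> k"
  shows "normal_depths f ts \<in> bounded_msets k n"
proof -
  have "length (normal_args safe f ts) \<le> length ts"
    unfolding normal_args_def length_nths using card_mono[of "{..<length ts}"]
    by (metis (no_types, lifting) card_lessThan finite_lessThan lessThan_iff mem_Collect_eq subsetI)
  with assms show ?thesis
    unfolding bounded_msets_def normal_depths_def normal_args_def args_depth_def
    by (auto simp: set_nths)
qed

text \<open>All symbols equivalent to \<open>f\<close> are treated simultaneously, since they may
  call each other. Their recursion is controlled by the rank of the multiset of normal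
  depths.\<close>

lemma bounding_defined:
  assumes f: "f \<in> D" and b: "\<And>g. prec_gt P f g \<Longrightarrow> bounding b g"
  shows "\<exists>b'. bounding b' f"
proof -
  have "\<exists>e. \<forall>g ss. fst \<rho> = Fun g ss \<longrightarrow> prec_eq P f g \<longrightarrow> pop_bounded g ss e (snd \<rho>)"
    if \<rho>: "\<rho> \<in> R" for \<rho>
  proof -
    obtain l r where lr: "\<rho> = (l, r)" "(l, r) \<in> R" using \<rho> by (cases \<rho>) auto
    obtain g ss where l: "l = Fun g ss" "g \<in> D" "\<forall>s\<in>set ss. funs_term s \<inter> D = {}"
      using rule_root[OF lr(2)] by metis
    show ?thesis
    proof (cases "prec_eq P f g")
      case True
      \<comment> \<open>By transitivity the symbols below \<open>g\<close> are also below
        \<open>f\<close>, so the hypothesis for \<open>f\<close> serves the rules of every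
        equivalent symbol.\<close>
      then have "bounding b h" if "prec_gt P g h" for h
        using that b P_trans unfolding prec_gt_def prec_eq_def by blast
      from pop_gt_bounded[OF l(2,3) this] rule_rhs[OF lr(2)] l(1)
      obtain e where "pop_bounded g ss e r" by blast
      with lr(1) l(1) show ?thesis by auto
    qed (use lr(1) l(1) in auto)
  qed
  then obtain es where es: "\<And>l r g ss. (l, r) \<in> R \<Longrightarrow> l = Fun g ss \<Longrightarrow> prec_eq P f g \<Longrightarrow>
      pop_bounded g ss (es (l, r)) r"
    by (metis fst_conv snd_conv)
  define e where "e = (\<Sum>\<rho>\<in>R. es \<rho>)"
  \<comment> \<open>A common bound on the number of normal arguments, so that calls to different
    symbols are ranked in the same set of multisets.\<close>
  define k where "k = (\<Sum>g\<in>UNIV. ar g)"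
  have ar_le: "ar g \<le> k" for g
    unfolding k_def by (rule member_le_sum) auto
  have "finite R"
    using constructor unfolding constructor_trs_def is_trs_def by blast
  then have es_le: "poly (es \<rho>) n \<le> poly e n" if "\<rho> \<in> R" for \<rho> n
    unfolding e_def using that by (rule poly_le_sum_nat)
  \<comment> \<open>This solves a recurrence: one root step, a cost \<open>poly e n\<close> for the
    right-hand side, and the bound for recursive calls of smaller rank.\<close>
  have main: "eval_bound D R (Suc (mset_rank k n (normal_depths g ts)) * Suc (poly e n) + m)
      (Suc (mset_rank k n (normal_depths g ts)) * Suc (poly e n)) (Fun g ts)"
    if "prec_eq P f g" "length ts = ar g" "\<forall>t\<in>set ts. normal_form R t" "args_depth g ts n m"
    for g ts n m
    using that
  proof (induction "mset_rank k n (normal_depths g ts)" arbitrary: g ts rule: less_induct)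
    case less
    let ?r = "mset_rank k n (normal_depths g ts)" and ?E = "poly e n"
    have g: "g \<in> D" using less.prems(1) f admissible unfolding admissible_def by blast
    \<comment> \<open>A smaller rank \<open>r'\<close> satisfies \<open>Suc r' \<le> ?r\<close>, so
      its bound fits into \<open>?r * Suc ?E\<close>. At rank 0 the claim is vacuous.\<close>
    have calls: "calls_bounded g (normal_depths g ts) n m (?r * Suc ?E)"
      unfolding calls_bounded_def
    proof (intro allI impI)
      fix h us
      assume h: "prec_eq P g h" "length us = ar h" "\<forall>t\<in>set us. normal_form R t"
        "args_depth h us n m" "normal_depths h us < normal_depths g ts"
      have "normal_depths h us \<in> bounded_msets k n"
        using normal_depths_bounded[OF h(4)] h(2) ar_le by simp
      then have rank: "mset_rank k n (normal_depths h us) < ?r"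
        using mset_rank_less h(5) by blast
      have "prec_eq P f h"
        using less.prems(1) h(1) P_trans unfolding prec_eq_def by blast
      from less.hyps[OF rank this h(2-4)]
      show "eval_bound D R (?r * Suc ?E + m) (?r * Suc ?E) (Fun h us)"
        using mult_le_mono1[of "Suc (mset_rank k n (normal_depths h us))" ?r "Suc ?E"] rank
        by (elim eval_bound_mono) auto
    qed
    show ?case
    proof (rule eval_boundI)
      \<comment> \<open>A call that is stuck counts as a constant of depth 1.\<close>
      show "nf_depth D (Fun g ts) \<le> Suc ?r * Suc ?E + m"
        using g by simp
      fix u assume "istep R (Fun g ts) u"
      then show "\<exists>c. Suc ?r * Suc ?E = Suc c \<and> eval_bound D R (Suc ?r * Suc ?E + m) c u"
      proof cases
        case (root l r \<sigma>)
        obtain g' ss where "l = Fun g' ss" using rule_root[OF root(2)] by metis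
        with root(3) have l: "l = Fun g ss" and ts: "ts = map (\<lambda>s. subst s \<sigma>) ss" by auto
        have "normal_form R (\<sigma> x)" if "x \<in> vars_term (Fun g ss)" for x
          using that less.prems(3) ts by (auto intro: normal_form_subst_var)
        then have "nf_instance g ss \<sigma> n m"
          using less.prems(4) ts unfolding nf_instance_def by simp
        moreover have "pop_bounded g ss (es (l, r)) r"
          using es root(2) l less.prems(1) by blast
        ultimately have "eval_bound D R
            (poly (es (l, r)) n + (if r \<in> terms_below P g then 0 else ?r * Suc ?E) + m)
            (poly (es (l, r)) n + (if r \<in> terms_below P g then 0 else ?r * Suc ?E)) (subst r \<sigma>)"
          using calls ts unfolding pop_bounded_def Let_def by simp
        then have "eval_bound D R (Suc ?r * Suc ?E + m) (?E + ?r * Suc ?E) (subst r \<sigma>)"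
          using es_le[OF root(2), of n] by (elim eval_bound_mono) auto
        \<comment> \<open>The outer successor pays for the root step.\<close>
        moreover have "Suc ?r * Suc ?E = Suc (?E + ?r * Suc ?E)" by simp
        ultimately show ?thesis unfolding root(1) by blast
      next
        case (arg s t us vs)
        then have "normal_form R s" using less.prems(3) by simp
        then show ?thesis using arg(3) istep_imp_rstep unfolding normal_form_def by blast
      qed
    qed
  qed
  \<comment> \<open>The sum of powers of \<open>n + 1\<close> bounds the rank. The two added ones
    mirror the successors in \<open>main\<close>.\<close>
  define b' where "b' = ((\<Sum>i\<le>k. [:1, 1:] ^ i) + 1) * (e + 1)"
  have "bounding b' f"
    unfolding bounding_def
  proof (intro allI impI)
    fix ts :: "('f, 'v) term list" and n m
    assume ts: "length ts = ar f" "\<forall>t\<in>set ts. normal_form R t" "args_depth f ts n m"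
    have "poly b' n = Suc (\<Sum>i\<le>k. Suc n ^ i) * Suc (poly e n)"
      unfolding b'_def by (simp add: poly_sum poly_power)
    then have "Suc (mset_rank k n (normal_depths f ts)) * Suc (poly e n) \<le> poly b' n"
      using mset_rank_le by (metis Suc_le_mono mult_le_mono1)
    with main[OF _ ts] show "eval_bound D R (poly b' n + m) (poly b' n) (Fun f ts)"
      using P_refl unfolding prec_eq_def by (meson add_right_mono eval_bound_mono)
  qed
  then show ?thesis ..
qed

lemma ex_bounding: "\<exists>b. bounding b f"
  using wf_prec_gt
proof (induction f rule: wf_induct_rule)
  case (less f)
  then obtain bs where bs: "\<And>g. prec_gt P f g \<Longrightarrow> bounding (bs g) g"
    by (simp, metis)
  \<comment> \<open>One polynomial is required for all symbols below \<open>f\<close>. The values of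
    \<open>bs\<close> at other symbols only enlarge the sum.\<close>
  have "bounding (\<Sum>g\<in>UNIV. bs g) g" if "prec_gt P f g" for g
    using bs[OF that] by (rule bounding_mono) (rule poly_le_sum_nat, auto)
  then show ?case
    using bounding_constructor bounding_defined by (cases "f \<in> D") blast+
qed

theorem derivation_height_poly:
  "\<exists>p. \<forall>f ts. is_basic ar D (Fun f ts :: ('f, 'v) term) \<longrightarrow>
     derivation_height R (Fun f ts)
       \<le> enat (poly p (Max ({0} \<union> depth ` set (normal_args safe f ts))))"
proof -
  obtain bs where bs: "\<And>f. bounding (bs f) f" using ex_bounding by metis
  define p where "p = (\<Sum>f\<in>UNIV. bs f)"
  have "derivation_height R (Fun f ts)
      \<le> enat (poly p (Max ({0} \<union> depth ` set (normal_args safe f ts))))"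
    if basic: "is_basic ar D (Fun f ts)" for f and ts :: "('f, 'v) term list"
  proof -
    let ?n = "Max ({0} \<union> depth ` set (normal_args safe f ts))"
    \<comment> \<open>The overall depth serves as the safe limit. It affects only the depth of
      results, so it drops out of the bound on the height.\<close>
    let ?m = "Max ({0} \<union> depth ` set ts)"
    have len: "length ts = ar f" and val: "\<And>t. t \<in> set ts \<Longrightarrow> funs_term t \<inter> D = {}"
      using basic unfolding is_basic_def is_value_def by auto
    have "depth (ts ! i) \<le> (if i \<in> safe f then ?m else ?n)" if "i < length ts" for i
    proof (cases "i \<in> safe f")
      case False
      with that have "ts ! i \<in> set (normal_args safe f ts)"
        unfolding normal_args_def by (auto simp: set_nths)
      with False show ?thesis by simp
    qed (use that in simp)
    then have "args_depth f ts ?n ?m"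
      unfolding args_depth_def using nf_depth_eq_depth[OF val] by simp
    then have "eval_bound D R (poly (bs f) ?n + ?m) (poly (bs f) ?n) (Fun f ts)"
      using bs[of f] len normal_form_value[OF val] unfolding bounding_def by blast
    then have "derivation_height R (Fun f ts) \<le> enat (poly (bs f) ?n)"
      by (rule derivation_height_le)
    also have "\<dots> \<le> enat (poly p ?n)"
      unfolding p_def by (simp add: poly_le_sum_nat)
    finally show ?thesis .
  qed
  then show ?thesis by blast
qed

end

section \<open>One polynomial for all safe mappings and precedences\<close>

lemma finite_safe_mappings: "finite {safe. safe_mapping (ar :: 'f :: finite \<Rightarrow> nat) D safe}"
proof (rule finite_subset)
  show "{safe. safe_mapping ar D safe} \<subseteq> (\<Pi>\<^sub>E f\<in>UNIV. Pow {..<ar f})"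
    unfolding safe_mapping_def by (auto simp: PiE_def)
  show "finite (\<Pi>\<^sub>E f\<in>UNIV. Pow {..<ar f})"
    by (intro finite_PiE) auto
qed

theorem theorem3p13:
  fixes ar :: "'f :: finite \<Rightarrow> nat"
    and D :: "'f set"
    and R :: "('f, 'v :: {countable, infinite}) trs"
  assumes "predicative_recursive ar D R"
  shows "(\<exists>p :: nat poly. \<forall>safe P. predicative_recursive_via ar D R safe P \<longrightarrow>
            (\<forall>f ts. is_basic ar D (Fun f ts :: ('f, 'v) term) \<longrightarrow>
               derivation_height R (Fun f ts)
                 \<le> enat (poly p (Max ({0} \<union> depth ` set (normal_args safe f ts))))))
       \<and> (\<exists>q :: nat poly. \<forall>n. runtime_complexity ar D R n \<le> enat (poly q n))"
proof -
  let ?via = "predicative_recursive_via ar D R"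
  let ?depth = "\<lambda>safe f ts. Max ({0} \<union> depth ` set (normal_args safe f ts))"
  have constructor: "constructor_trs ar D R" and "\<exists>safe P. ?via safe P"
    using assms unfolding predicative_recursive_def by auto
  then obtain safe0 P0 where via0: "?via safe0 P0" by blast
  \<comment> \<open>Over a finite signature only finitely many pairs are possible, so summing their
    polynomials gives one that depends on the system and the signature alone.\<close>
  define A where "A = {(safe, P). ?via safe P}"
  have "A \<subseteq> {safe. safe_mapping ar D safe} \<times> UNIV"
    unfolding A_def predicative_recursive_via_def by auto
  then have fin: "finite A"
    by (rule finite_subset) (simp add: finite_safe_mappings)
  have "\<exists>p. \<forall>f ts. is_basic ar D (Fun f ts :: ('f, 'v) term) \<longrightarrow>
      derivation_height R (Fun f ts) \<le> enat (poly p (?depth (fst a) f ts))" if "a \<in> A" for a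
  proof -
    have "predicative_trs ar D R (fst a) (snd a)"
      using that constructor unfolding A_def by (intro predicative_trs.intro) auto
    then show ?thesis by (rule predicative_trs.derivation_height_poly)
  qed
  then obtain ps where ps: "\<And>a f ts. a \<in> A \<Longrightarrow> is_basic ar D (Fun f ts :: ('f, 'v) term) \<Longrightarrow>
      derivation_height R (Fun f ts) \<le> enat (poly (ps a) (?depth (fst a) f ts))"
    by metis
  define p where "p = (\<Sum>a\<in>A. ps a)"
  have p: "derivation_height R (Fun f ts) \<le> enat (poly p (?depth safe f ts))"
    if "?via safe P" "is_basic ar D (Fun f ts)" for safe P f and ts :: "('f, 'v) term list"
  proof -
    have a: "(safe, P) \<in> A" using that(1) unfolding A_def by simp
    from ps[OF a that(2)]
    have "derivation_height R (Fun f ts) \<le> enat (poly (ps (safe, P)) (?depth safe f ts))" by simp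
    also have "\<dots> \<le> enat (poly p (?depth safe f ts))"
      unfolding p_def using poly_le_sum_nat[OF fin a] by simp
    finally show ?thesis .
  qed
  \<comment> \<open>Any one safe mapping will do here: the depth of a normal argument is at most the
    size of the basic term, and \<open>p\<close> is monotone.\<close>
  have "runtime_complexity ar D R n \<le> enat (poly p n)" for n
    unfolding runtime_complexity_def
  proof (rule SUP_least)
    fix s :: "('f, 'v) term"
    assume "s \<in> {s. is_basic ar D s \<and> term_size s \<le> n}"
    then have basic: "is_basic ar D s" and size: "term_size s \<le> n" by auto
    obtain f ts where s: "s = Fun f ts" using basic unfolding is_basic_def by blast
    have "depth t \<le> n" if "t \<in> set (normal_args safe0 f ts)" for t
    proof -
      have "t \<in> set ts" using that unfolding normal_args_def by (rule in_set_nthsD)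
      then have "depth t \<le> Max ({0} \<union> depth ` set ts)" by (intro Max_ge) auto
      also have "\<dots> \<le> depth s" unfolding s depth.simps by (rule le_add2)
      also have "\<dots> \<le> n" using depth_le_term_size size by (rule le_trans)
      finally show ?thesis .
    qed
    then have "?depth safe0 f ts \<le> n" by auto
    then have "enat (poly p (?depth safe0 f ts)) \<le> enat (poly p n)"
      using poly_nat_mono by simp
    with p[OF via0] basic s show "derivation_height R s \<le> enat (poly p n)"
      using order_trans by blast
  qed
  with p show ?thesis by blast
qed

end
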